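(* Let $T$ be a Toeplitz matrix of order $n$. The row graph of $T$ is a cycle (on all of its $n$ vertices) if and only if $T=T_n\langle i_1,i_2;j_1,j_2\rangle$ for some $i_1<i_2$ and $j_1<j_2$ with $i_1+j_2=i_2+j_1=n$ and $\gcd(n,i_1+j_1)=1$.
   Context: Write $[m]=\{1,\dots,m\}$. For disjoint subsets $\alpha=\{i_1<\cdots<i_{k_1}\}$ and $\beta=\{j_1<\cdots<j_{k_2}\}$ of $[n-1]$, not both empty, $T_n\langle\alpha;\beta\rangle=T_n\langle i_1,\ldots,i_{k_1};j_1,\ldots,j_{k_2}\rangle$ denotes the $n\times n$ $(0,1)$-matrix $(t_{u,v})$ with $t_{u,v}=1$ if and only if $u-v\in\alpha$ or $v-u\in\beta$; "Toeplitz matrix of order $n$" here means a matrix of this form. The row graph $\mathrm{RG}(T)$ of an $n\times n$ $(0,1)$-matrix $T=(t_{u,v})$ is the simple graph with vertex set $[n]$ in which two distinct vertices $u,v$ are adjacent if and only if $t_{u,k}=t_{v,k}=1$ for some $k\in[n]$. *)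

theory Defs
  imports "Jordan_Normal_Form.Matrix" "Graph_Theory.Graph_Theory"
begin

text \<open>
  Matrix indices start at 0, as in \<^theory>\<open>Jordan_Normal_Form.Matrix\<close>, so the vertex set
  \<open>[n]\<close> of a row graph becomes \<open>{0..<n}\<close>. A Toeplitz matrix depends only on the
  differences of row and column indices, which this shift does not change.
\<close>

definition toeplitz_index_sets :: "nat \<Rightarrow> nat set \<Rightarrow> nat set \<Rightarrow> bool" where
  "toeplitz_index_sets n \<alpha> \<beta> \<longleftrightarrow>
     \<alpha> \<subseteq> {1..<n} \<and> \<beta> \<subseteq> {1..<n} \<and> \<alpha> \<inter> \<beta> = {} \<and> \<not> (\<alpha> = {} \<and> \<beta> = {})"

text \<open>The differences are taken in \<^typ>\<open>int\<close> because subtraction on \<^typ>\<open>nat\<close> truncates.\<close>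

definition toeplitz_mat :: "nat \<Rightarrow> nat set \<Rightarrow> nat set \<Rightarrow> 'a :: zero_neq_one mat" where
  "toeplitz_mat n \<alpha> \<beta> =
     mat n n (\<lambda>(u, v). if int u - int v \<in> int ` \<alpha> \<or> int v - int u \<in> int ` \<beta> then 1 else 0)"

definition is_toeplitz :: "nat \<Rightarrow> 'a :: zero_neq_one mat \<Rightarrow> bool" where
  "is_toeplitz n T \<longleftrightarrow> (\<exists>\<alpha> \<beta>. toeplitz_index_sets n \<alpha> \<beta> \<and> T = toeplitz_mat n \<alpha> \<beta>)"

text \<open>A simple graph is represented by its symmetric, loop-free set of arcs.\<close>

definition row_graph :: "'a :: zero_neq_one mat \<Rightarrow> nat pair_pre_digraph" where
  "row_graph T =
     \<lparr> pverts = {0..<dim_row T},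
       parcs = {(u, v). u < dim_row T \<and> v < dim_row T \<and> u \<noteq> v \<and>
                  (\<exists>k < dim_col T. T $$ (u, k) = 1 \<and> T $$ (v, k) = 1)} \<rparr>"

lemma pair_graph_row_graph: "pair_graph (row_graph T)"
proof -
  have "parcs (row_graph T) \<subseteq> {0..<dim_row T} \<times> {0..<dim_row T}"
    by (auto simp: row_graph_def)
  then have "finite (parcs (row_graph T))"
    by (rule finite_subset) simp
  then show ?thesis
    by unfold_locales (auto simp: row_graph_def symmetric_def intro!: symI)
qed

text \<open>
  The whole graph is a cycle: it consists of the vertices and edges of one cycle \<open>p\<close>, each edge
  being present as a pair of opposite arcs. As \<open>u, v, u\<close> counts as a cycle of the directed graph
  when \<open>u\<close> and \<open>v\<close> are adjacent, the length of \<open>p\<close> has to be bounded below.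
\<close>

definition is_cycle_graph :: "'v pair_pre_digraph \<Rightarrow> bool" where
  "is_cycle_graph G \<longleftrightarrow>
     (\<exists>p. pre_digraph.cycle (with_proj G) p \<and> 3 \<le> length p \<and>
          pverts G = fst ` set p \<and> parcs G = set p \<union> (set p)\<inverse>)"

end

theory Submission
  imports Defs "HOL-Number_Theory.Cong"
begin

text \<open>
  Two rows are adjacent exactly when some column has a one in both. Suppose that the row graph is
  a cycle. A column with three ones would give a triangle, so the cycle would have length 3; but
  the diagonal is zero, so a column of a matrix of order 3 has at most two ones. Hence each column
  accounts for at most one edge. The cycle has \<open>n\<close> edges and there are \<open>n\<close> columns, so every column
  has exactly two ones (\<open>column_ones_card_eq_2\<close>).

  In a Toeplitz matrix, column \<open>k\<close> is column \<open>k - 1\<close> shifted down by one; the entry \<open>[n - k \<in> \<alpha>]\<close>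
  drops out at the bottom and \<open>[k \<in> \<beta>]\<close> comes in at the top. Constant column sums therefore force
  \<open>\<beta> = n - \<alpha>\<close> (\<open>index_sets_complementary_if_columns_equicardinal\<close>), and column \<open>0\<close>, whose ones are
  in the rows \<open>\<alpha>\<close>, gives \<open>card \<alpha> = 2\<close>. These are the equations \<open>i\<^sub>1 + j\<^sub>2 = i\<^sub>2 + j\<^sub>1 = n\<close>.

  Under these equations \<open>k - j\<^sub>2 \<equiv> k + i\<^sub>1\<close> and \<open>k - j\<^sub>1 \<equiv> k + i\<^sub>2\<close> modulo \<open>n\<close>, so the matrix is a circulant
  and the ones of column \<open>k\<close> lie in the rows \<open>k + i\<^sub>1\<close> and \<open>k + i\<^sub>2\<close> modulo \<open>n\<close>. The row graph then joins
  each \<open>u\<close> to \<open>u + s\<close> modulo \<open>n\<close>, where \<open>s = i\<^sub>1 + j\<^sub>1 \<equiv> i\<^sub>1 - i\<^sub>2\<close>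
  (\<open>parcs_row_graph_complementary\<close>). The vertices \<open>0, s, 2 s, \<dots>\<close> run through all residues iff
  \<open>s\<close> is prime to \<open>n\<close>, and otherwise the graph is disconnected (\<open>circulant_is_cycle_graph_iff\<close>).
\<close>

section \<open>Cycle graphs as cyclic enumerations\<close>

text \<open>
  The arcs of the cycle \<open>f 0, \<dots>, f (m - 1), f 0\<close>, traversed once in one direction.
\<close>

definition consecutive_pairs :: "nat \<Rightarrow> (nat \<Rightarrow> 'v) \<Rightarrow> ('v \<times> 'v) set" where
  "consecutive_pairs m f = (\<lambda>t. (f t, f (Suc t mod m))) ` {..<m}"

lemma cas_with_proj_iff_nth:
  assumes "p \<noteq> []"
  shows "pre_digraph.cas (with_proj G) u p v \<longleftrightarrow>
    fst (hd p) = u \<and> snd (last p) = v \<and> (\<forall>i. Suc i < length p \<longrightarrow> fst (p ! Suc i) = snd (p ! i))"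
  using assms
proof (induction p arbitrary: u rule: list_nonempty_induct)
  case (single e)
  then show ?case by (auto simp: pre_digraph.cas.simps)
next
  case (cons e p)
  then have "pre_digraph.cas (with_proj G) u (e # p) v \<longleftrightarrow>
     fst e = u \<and> fst (hd p) = snd e \<and> snd (last p) = v \<and>
     (\<forall>i. Suc i < length p \<longrightarrow> fst (p ! Suc i) = snd (p ! i))"
    by (cases e) (simp add: pre_digraph.cas.simps del: cas_with_proj_eq)
  moreover have "(\<forall>i. Suc i < length (e # p) \<longrightarrow> fst ((e # p) ! Suc i) = snd ((e # p) ! i)) \<longleftrightarrow>
     fst (hd p) = snd e \<and> (\<forall>i. Suc i < length p \<longrightarrow> fst (p ! Suc i) = snd (p ! i))"
    using cons(1) by (auto simp: nth_Cons hd_conv_nth split: nat.splits)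
  ultimately show ?case using cons(1) by auto
qed

text \<open>
  Reading the indices modulo the length turns the consecutive arcs of a closed walk and the return
  to its start into one condition. Repetition of vertices can be tested on the heads of the arcs:
  the walk visits these after its start.
\<close>

lemma cycle_with_proj_iff_nth:
  "pre_digraph.cycle (with_proj G) p \<longleftrightarrow>
    p \<noteq> [] \<and> fst (hd p) \<in> pverts G \<and> set p \<subseteq> parcs G \<and> distinct (map snd p) \<and>
    (\<forall>i < length p. fst (p ! (Suc i mod length p)) = snd (p ! i))"
proof (cases "p = []")
  case True
  then show ?thesis by (simp add: pre_digraph.cycle_def)
next
  case False
  have closed: "(\<forall>i < length p. fst (p ! (Suc i mod length p)) = snd (p ! i)) \<longleftrightarrow>
      snd (last p) = fst (hd p) \<and>
      (\<forall>i. Suc i < length p \<longrightarrow> fst (p ! Suc i) = snd (p ! i))" (is "?L \<longleftrightarrow> ?R")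
  proof
    assume L: ?L
    then have "fst (p ! (Suc (length p - 1) mod length p)) = snd (p ! (length p - 1))"
      using False by (meson diff_less length_greater_0_conv less_one)
    moreover have "fst (p ! Suc i) = snd (p ! i)" if "Suc i < length p" for i
      using L[rule_format, of i] that by simp
    ultimately show ?R using False by (simp add: hd_conv_nth last_conv_nth)
  next
    assume R: ?R
    show ?L
    proof (intro allI impI)
      fix i assume "i < length p"
      then consider "Suc i < length p" | "i = length p - 1" "Suc i = length p" by linarith
      then show "fst (p ! (Suc i mod length p)) = snd (p ! i)"
        using R False by cases (auto simp: hd_conv_nth last_conv_nth)
    qed
  qed
  have verts: "tl (pre_digraph.awalk_verts (with_proj G) u p) = map snd p"
    if "pre_digraph.cas (with_proj G) u p v" for u v
    using pre_digraph.awalk_verts_conv'[OF that] False by simp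
  have "pre_digraph.cycle (with_proj G) p \<longleftrightarrow>
     (\<exists>u. u \<in> pverts G \<and> set p \<subseteq> parcs G \<and> pre_digraph.cas (with_proj G) u p u \<and>
        distinct (map snd p))"
    unfolding pre_digraph.cycle_def pre_digraph.awalk_def
    using False verts by (simp del: cas_with_proj_eq awalk_verts_with_proj_eq) metis
  also have "\<dots> \<longleftrightarrow> fst (hd p) \<in> pverts G \<and> set p \<subseteq> parcs G \<and> distinct (map snd p) \<and>
      snd (last p) = fst (hd p) \<and>
      (\<forall>i. Suc i < length p \<longrightarrow> fst (p ! Suc i) = snd (p ! i))"
    unfolding cas_with_proj_iff_nth[OF False] by auto
  finally show ?thesis using closed False by blast
qed

lemma image_Suc_mod: "(\<lambda>t. Suc t mod m) ` {..<m} = {..<m}"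
proof (cases "m = 0")
  case False
  have "t \<in> (\<lambda>t. Suc t mod m) ` {..<m}" if "t < m" for t
  proof (cases t)
    case 0
    then show ?thesis using False by (intro image_eqI[of _ _ "m - 1"]) auto
  next
    case (Suc s)
    then show ?thesis using that by (intro image_eqI[of _ _ s]) auto
  qed
  then show ?thesis using False by auto
qed simp

text \<open>
  Replaces walks by a cyclic enumeration of the vertices, so that adjacency becomes arithmetic
  on indices modulo \<open>m\<close>.
\<close>

lemma is_cycle_graph_iff_enumeration:
  "is_cycle_graph G \<longleftrightarrow>
    (\<exists>m f. 3 \<le> m \<and> inj_on f {..<m} \<and> pverts G = f ` {..<m} \<and>
       parcs G = consecutive_pairs m f \<union> (consecutive_pairs m f)\<inverse>)"
proof
  assume "is_cycle_graph G"
  then obtain p where p: "pre_digraph.cycle (with_proj G) p" "3 \<le> length p"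
      "pverts G = fst ` set p" "parcs G = set p \<union> (set p)\<inverse>"
    unfolding is_cycle_graph_def by blast
  define m where "m = length p"
  \<comment> \<open>With heads instead of tails, distinctness of \<open>f\<close> is literally the condition on a cycle;
    the arc from \<open>f t\<close> is then \<open>p ! (t + 1)\<close>.\<close>
  define f where "f t = snd (p ! t)" for t
  have arc: "p ! (Suc t mod m) = (f t, f (Suc t mod m))" if "t < m" for t
    using p(1) that by (auto simp: cycle_with_proj_iff_nth m_def f_def prod_eq_iff)
  have "set p = (\<lambda>t. p ! t) ` (\<lambda>t. Suc t mod m) ` {..<m}"
    unfolding image_Suc_mod by (auto simp: m_def set_conv_nth)
  also have "\<dots> = consecutive_pairs m f"
    using arc by (auto simp: consecutive_pairs_def image_image intro!: image_cong)
  finally have set_p: "set p = consecutive_pairs m f" .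
  have "distinct (map snd p)" using p(1) by (simp add: cycle_with_proj_iff_nth)
  then have "inj_on f {..<m}"
    by (auto simp: inj_on_def f_def m_def distinct_conv_nth)
  moreover have "pverts G = f ` {..<m}"
    unfolding p(3) set_p consecutive_pairs_def by (simp add: image_image)
  ultimately show "\<exists>m f. 3 \<le> m \<and> inj_on f {..<m} \<and> pverts G = f ` {..<m} \<and>
       parcs G = consecutive_pairs m f \<union> (consecutive_pairs m f)\<inverse>"
    using p(2,4) set_p m_def by metis
next
  assume "\<exists>m f. 3 \<le> m \<and> inj_on f {..<m} \<and> pverts G = f ` {..<m} \<and>
       parcs G = consecutive_pairs m f \<union> (consecutive_pairs m f)\<inverse>"
  then obtain m f where m: "3 \<le> m" and f: "inj_on f {..<m}" "pverts G = f ` {..<m}"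
      "parcs G = consecutive_pairs m f \<union> (consecutive_pairs m f)\<inverse>"
    by blast
  define p where "p = map (\<lambda>t. (f t, f (Suc t mod m))) [0..<m]"
  have set_p: "set p = consecutive_pairs m f"
    by (auto simp: p_def consecutive_pairs_def)
  have len: "length p = m" by (simp add: p_def)
  have nth: "p ! t = (f t, f (Suc t mod m))" if "t < m" for t
    using that by (simp add: p_def)
  have ne: "p \<noteq> []" using m len by auto
  have hd_p: "fst (hd p) = f 0" using ne len nth[of 0] m by (simp add: hd_conv_nth)
  have "inj_on (\<lambda>t. Suc t mod m) {..<m}"
    by (rule eq_card_imp_inj_on) (simp_all add: image_Suc_mod)
  then have "inj_on (\<lambda>t. f (Suc t mod m)) {..<m}"
    using comp_inj_on[of "\<lambda>t. Suc t mod m" "{..<m}" f] f(1) by (simp add: image_Suc_mod o_def)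
  then have "distinct (map snd p)"
    by (simp add: p_def distinct_map o_def lessThan_atLeast0)
  then have "pre_digraph.cycle (with_proj G) p"
    unfolding cycle_with_proj_iff_nth len
    using ne hd_p f(2,3) m set_p by (auto simp: nth)
  moreover have "pverts G = fst ` set p"
    unfolding f(2) set_p consecutive_pairs_def by (simp add: image_image)
  ultimately show "is_cycle_graph G"
    unfolding is_cycle_graph_def using set_p f(3) m len by metis
qed

section \<open>Columns of a Toeplitz matrix\<close>

definition column_ones :: "'a :: zero_neq_one mat \<Rightarrow> nat \<Rightarrow> nat set" where
  "column_ones T k = {u. u < dim_row T \<and> T $$ (u, k) = 1}"

lemma finite_column_ones [simp]: "finite (column_ones T k)"
  unfolding column_ones_def by simp

lemma dim_toeplitz_mat [simp]:
  "dim_row (toeplitz_mat n \<alpha> \<beta>) = n" "dim_col (toeplitz_mat n \<alpha> \<beta>) = n"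
  by (simp_all add: toeplitz_mat_def)

lemma in_parcs_row_graph_iff:
  "(u, v) \<in> parcs (row_graph T) \<longleftrightarrow>
     u \<noteq> v \<and> (\<exists>k < dim_col T. u \<in> column_ones T k \<and> v \<in> column_ones T k)"
  by (auto simp: row_graph_def column_ones_def)

lemma pverts_row_graph [simp]: "pverts (row_graph T) = {0..<dim_row T}"
  by (simp add: row_graph_def)

lemma column_ones_toeplitz:
  assumes "k < n"
  shows "u \<in> column_ones (toeplitz_mat n \<alpha> \<beta>) k \<longleftrightarrow>
    u < n \<and> ((\<exists>i\<in>\<alpha>. u = k + i) \<or> (\<exists>j\<in>\<beta>. k = u + j))"
proof -
  have "int u - int k \<in> int ` \<alpha> \<longleftrightarrow> (\<exists>i\<in>\<alpha>. u = k + i)" by force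
  moreover have "int k - int u \<in> int ` \<beta> \<longleftrightarrow> (\<exists>j\<in>\<beta>. k = u + j)" by force
  ultimately show ?thesis
    using assms by (auto simp: column_ones_def toeplitz_mat_def)
qed

text \<open>
  Passing from column \<open>k - 1\<close> to column \<open>k\<close> shifts the ones down by one row. A one is lost at the
  bottom iff \<open>n - k \<in> \<alpha>\<close> and gained at the top iff \<open>k \<in> \<beta>\<close>; since the number of ones does not
  change, both happen or neither does.
\<close>

lemma index_sets_complementary_if_columns_equicardinal:
  fixes T :: "'a :: zero_neq_one mat"
  assumes T: "T = toeplitz_mat n \<alpha> \<beta>" and sub: "\<alpha> \<subseteq> {1..<n}" "\<beta> \<subseteq> {1..<n}"
    and card: "\<And>k. k < n \<Longrightarrow> card (column_ones T k) = c"
  shows "\<beta> = (\<lambda>i. n - i) ` \<alpha>"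
proof -
  have iff: "k \<in> \<beta> \<longleftrightarrow> n - k \<in> \<alpha>" if k: "1 \<le> k" "k < n" for k
  proof -
    obtain l where l: "k = Suc l" using k(1) by (cases k) auto
    let ?A = "column_ones T l" and ?B = "column_ones T k"
    have ones: "u \<in> ?A \<longleftrightarrow> u < n \<and> ((\<exists>i\<in>\<alpha>. u = l + i) \<or> (\<exists>j\<in>\<beta>. l = u + j))"
      "u \<in> ?B \<longleftrightarrow> u < n \<and> ((\<exists>i\<in>\<alpha>. u = k + i) \<or> (\<exists>j\<in>\<beta>. k = u + j))" for u
      using column_ones_toeplitz k l T by (metis Suc_lessD, metis)
    have A: "n - 1 \<in> ?A \<longleftrightarrow> n - k \<in> \<alpha>"
    proof
      assume "n - 1 \<in> ?A"
      then obtain i where "i \<in> \<alpha>" "n - 1 = l + i" using k l unfolding ones by auto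
      then show "n - k \<in> \<alpha>" using k l by (metis Suc_diff_1 add_Suc add_diff_cancel_left' gr_zeroI not_less0)
    next
      assume "n - k \<in> \<alpha>"
      moreover have "n - 1 = l + (n - k)" using k l by simp
      ultimately have "\<exists>i\<in>\<alpha>. n - 1 = l + i" by blast
      then show "n - 1 \<in> ?A" using k by (simp add: ones)
    qed
    have B: "0 \<in> ?B \<longleftrightarrow> k \<in> \<beta>"
      using k by (auto simp: ones)
    have shift: "Suc u \<in> ?B \<longleftrightarrow> u \<in> ?A \<and> u \<noteq> n - 1" for u
      unfolding ones using k l by auto
    have "?B - {0} = Suc ` (?A - {n - 1})"
    proof (intro equalityI subsetI)
      fix u assume "u \<in> ?B - {0}"
      then show "u \<in> Suc ` (?A - {n - 1})" using shift by (cases u) auto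
    qed (use shift in auto)
    then have "card (?B - {0}) = card (?A - {n - 1})"
      by (simp add: card_image)
    moreover have "card ?A = card ?B" using card[of k] card[of l] k l by simp
    moreover have "card ?A > 0" if "n - 1 \<in> ?A" using that by (auto simp: card_gt_0_iff)
    moreover have "card ?B > 0" if "0 \<in> ?B" using that by (auto simp: card_gt_0_iff)
    ultimately have "0 \<in> ?B \<longleftrightarrow> n - 1 \<in> ?A"
      by (auto simp: card_Diff_singleton_if split: if_splits)
    then show ?thesis using A B by simp
  qed
  show ?thesis
  proof (intro equalityI subsetI)
    fix k assume k: "k \<in> \<beta>"
    then have "1 \<le> k" "k < n" using sub by auto
    then show "k \<in> (\<lambda>i. n - i) ` \<alpha>" using iff[of k] k by (intro image_eqI[of _ _ "n - k"]) auto
  next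
    fix k assume "k \<in> (\<lambda>i. n - i) ` \<alpha>"
    then obtain i where i: "i \<in> \<alpha>" "k = n - i" by blast
    then have "1 \<le> i" "i < n" using sub by auto
    then show "k \<in> \<beta>" using iff[of k] i by simp
  qed
qed

lemma column_zero_toeplitz:
  assumes "\<alpha> \<subseteq> {1..<n}" "\<beta> \<subseteq> {1..<n}" "0 < n"
  shows "column_ones (toeplitz_mat n \<alpha> \<beta>) 0 = \<alpha>"
  using assms by (auto simp: column_ones_toeplitz set_eq_iff)

section \<open>Every column has exactly two ones\<close>

text \<open>The only cycle that contains a triangle is the triangle itself.\<close>

lemma cyclically_adjacent_triple:
  assumes "a < n" "b < n" "c < n" "a \<noteq> b" "a \<noteq> c" "b \<noteq> c"
    and "b = Suc a mod n \<or> a = Suc b mod n"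
    and "c = Suc a mod n \<or> a = Suc c mod n"
    and "c = Suc b mod n \<or> b = Suc c mod n"
  shows "n = 3"
proof -
  have "Suc x mod n = (if Suc x = n then 0 else Suc x)" if "x < n" for x
    using that by auto
  then show ?thesis using assms by (auto split: if_splits)
qed

text \<open>
  Assign to each edge of the cycle a column that witnesses it. No column has more than two ones, so
  the two ends of the edge are all the ones of its column, and the assignment is injective. It maps
  \<open>n\<close> edges to \<open>n\<close> columns, hence reaches every column.
\<close>

lemma column_ones_card_eq_2:
  fixes T :: "'a :: zero_neq_one mat"
  assumes dim: "dim_row T = n" "dim_col T = n" and diag: "\<And>k. k < n \<Longrightarrow> T $$ (k, k) \<noteq> 1"
    and cyc: "is_cycle_graph (row_graph T)" and k: "k < n"
  shows "card (column_ones T k) = 2"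
proof -
  obtain m f where m3: "3 \<le> m" and inj: "inj_on f {..<m}" and V: "{0..<n} = f ` {..<m}"
      and E: "parcs (row_graph T) = consecutive_pairs m f \<union> (consecutive_pairs m f)\<inverse>"
    using cyc dim unfolding is_cycle_graph_iff_enumeration by auto
  have "card {0..<n} = card {..<m}" unfolding V using card_image[OF inj] .
  then have m: "m = n" by simp
  note E = E[unfolded m] and V = V[unfolded m] and inj = inj[unfolded m] and n3 = m3[unfolded m]
  have f_eq: "f a = f b \<longleftrightarrow> a = b" if "a < n" "b < n" for a b
    using inj that by (auto simp: inj_on_def)
  have adj: "b = Suc a mod n \<or> a = Suc b mod n"
    if "a < n" "b < n" "f a \<in> column_ones T k" "f b \<in> column_ones T k" "a \<noteq> b" "k < n" for a b k
  proof -
    have "(f a, f b) \<in> parcs (row_graph T)"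
      using that f_eq by (auto simp: in_parcs_row_graph_iff dim)
    then show ?thesis
      unfolding E consecutive_pairs_def using that f_eq by auto
  qed
  have le: "card (column_ones T k) \<le> 2" if k: "k < n" for k
  proof (rule ccontr)
    assume "\<not> card (column_ones T k) \<le> 2"
    then have "3 \<le> card (column_ones T k)" by simp
    then obtain S where S: "S \<subseteq> column_ones T k" "card S = 3"
      by (meson obtain_subset_with_card_n)
    then obtain u v w where uvw: "S = {u, v, w}" "u \<noteq> v" "u \<noteq> w" "v \<noteq> w"
      by (auto simp: card_3_iff)
    have "S \<subseteq> {0..<n}" using S(1) by (auto simp: column_ones_def dim)
    then have "S \<subseteq> f ` {..<n}" unfolding V .
    then obtain a b c where abc: "a < n" "b < n" "c < n" "u = f a" "v = f b" "w = f c"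
      using uvw(1) by auto
    \<comment> \<open>The column itself then gives a fourth index \<open>k\<close> below 3, as the diagonal has no ones.\<close>
    have "n = 3"
      by (rule cyclically_adjacent_triple[of a n b c])
        (use abc uvw S(1) k adj[of _ _ k] in auto)
    moreover have "insert k S \<subseteq> {0..<n}" "k \<notin> S"
      using S(1) k diag[OF k] by (auto simp: column_ones_def dim)
    ultimately have "card (insert k S) \<le> 3" using card_mono[of "{0..<n}" "insert k S"] by simp
    then show False using \<open>k \<notin> S\<close> S(2) uvw(1) by simp
  qed
  have Suc_ne: "Suc t mod n \<noteq> t" "Suc (Suc t mod n) mod n \<noteq> t" if "t < n" for t
    using that n3 by (auto simp: mod_Suc)
  have "\<exists>k<n. {f t, f (Suc t mod n)} \<subseteq> column_ones T k" if "t < n" for t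
  proof -
    have "(f t, f (Suc t mod n)) \<in> parcs (row_graph T)"
      unfolding E consecutive_pairs_def using that by auto
    then show ?thesis by (auto simp: in_parcs_row_graph_iff dim)
  qed
  then obtain col where col: "\<And>t. t < n \<Longrightarrow> col t < n"
      "\<And>t. t < n \<Longrightarrow> {f t, f (Suc t mod n)} \<subseteq> column_ones T (col t)"
    by metis
  have pair: "column_ones T (col t) = {f t, f (Suc t mod n)}" if t: "t < n" for t
  proof -
    have "card {f t, f (Suc t mod n)} = 2" using Suc_ne[OF t] f_eq t by auto
    then show ?thesis
      using card_seteq[OF _ col(2)[OF t]] le[OF col(1)[OF t]] by simp
  qed
  have "inj_on col {..<n}"
  proof (rule inj_onI, rule ccontr)
    fix s t assume st: "s \<in> {..<n}" "t \<in> {..<n}" "col s = col t" "s \<noteq> t"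
    then have "{f s, f (Suc s mod n)} = {f t, f (Suc t mod n)}" 
      using pair[of s] pair[of t] by simp
    \<comment> \<open>One edge traversed in both directions would close the cycle after two steps.\<close>
    then have "s = Suc t mod n" "Suc s mod n = t"
      using st n3 f_eq by (auto simp: doubleton_eq_iff)
    then show False using Suc_ne st by auto
  qed
  then have "col ` {..<n} = {..<n}"
    using col(1) by (intro endo_inj_surj) auto
  then obtain t where t: "t < n" "k = col t" using k by (metis imageE lessThan_iff)
  then show ?thesis using pair[OF t(1)] Suc_ne[OF t(1)] f_eq t by auto
qed

section \<open>Complementary index sets give circulant graphs\<close>

text \<open>
  Modulo \<open>n\<close>, an offset \<open>n - i\<close> above the diagonal is the offset \<open>i\<close> below it, so the matrix is a
  circulant. The two ones of each column are \<open>i - i' \<equiv> i + (n - i')\<close> apart; the right-hand side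
  avoids a negative difference.
\<close>

lemma parcs_row_graph_complementary:
  fixes T :: "'a :: zero_neq_one mat"
  assumes T: "T = toeplitz_mat n {i, i'} {n - i', n - i}"
    and i: "1 \<le> i" "i < i'" "i' < n"
  shows "parcs (row_graph T) =
    {(u, v). u < n \<and> v < n \<and>
       (v = (u + (i + (n - i'))) mod n \<or> u = (v + (i + (n - i'))) mod n)}"
proof -
  define s where "s = i + (n - i')"
  have s: "0 < s" "s < n" using i by (auto simp: s_def)
  have ones: "column_ones T k = {(k + i) mod n, (k + i') mod n}" if k: "k < n" for k
  proof -
    have mods: "(k + x) mod n = (if k + x < n then k + x else k + x - n)" if "x < n" for x
      using that k by (simp add: mod_if)
    show ?thesis unfolding T using i k by (auto simp: column_ones_toeplitz mods set_eq_iff)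
  qed
  have step: "((k + i') mod n + s) mod n = (k + i) mod n" for k
  proof -
    have "k + i' + s = k + i + n" using i by (simp add: s_def)
    then have "(k + i' + s) mod n = (k + i) mod n" by (metis mod_add_self2)
    then show ?thesis by (simp add: mod_add_left_eq)
  qed
  have ne: "(u + s) mod n \<noteq> u" if "u < n" for u
    using that s by (cases "u + s < n") (auto simp: mod_if)
  have surj: "\<exists>k<n. (k + i') mod n = u" if "u < n" for u
  proof -
    have "((u + (n - i')) mod n + i') mod n = (u + (n - i') + i') mod n" by (simp add: mod_add_left_eq)
    also have "\<dots> = u" using i that by simp
    finally show ?thesis using that by (intro exI[of _ "(u + (n - i')) mod n"]) auto
  qed
  have arc: "(u, v) \<in> parcs (row_graph T)" if "u < n" "v = (u + s) mod n" for u v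
  proof -
    obtain k where k: "k < n" "(k + i') mod n = u" using surj \<open>u < n\<close> by blast
    then have "column_ones T k = {v, u}" using ones step that by metis
    moreover have "u \<noteq> v" using ne[OF that(1)] that(2) by simp
    ultimately show ?thesis using k(1) T by (auto simp: in_parcs_row_graph_iff)
  qed
  have "(u, v) \<in> parcs (row_graph T) \<longleftrightarrow>
      u < n \<and> v < n \<and> (v = (u + s) mod n \<or> u = (v + s) mod n)" for u v
  proof
    assume "(u, v) \<in> parcs (row_graph T)"
    then obtain k where k: "k < n" "u \<in> column_ones T k" "v \<in> column_ones T k" "u \<noteq> v"
      by (auto simp: in_parcs_row_graph_iff T)
    then show "u < n \<and> v < n \<and> (v = (u + s) mod n \<or> u = (v + s) mod n)"
      using ones[OF k(1)] step[of k] by auto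
  next
    assume "u < n \<and> v < n \<and> (v = (u + s) mod n \<or> u = (v + s) mod n)"
    then show "(u, v) \<in> parcs (row_graph T)"
      using arc[of u v] arc[of v u] by (auto simp: in_parcs_row_graph_iff)
  qed
  then show ?thesis unfolding s_def by auto
qed

text \<open>
  All arcs preserve residues modulo \<open>gcd n s\<close>, so the vertices \<open>0\<close> and \<open>1\<close> lie on a common cycle
  only if this number is 1. Conversely, if \<open>s\<close> is prime to \<open>n\<close>, the multiples of \<open>s\<close> enumerate
  the vertices in cyclic order.
\<close>

lemma circulant_is_cycle_graph_iff:
  fixes n s :: nat
  assumes n: "3 \<le> n" and V: "pverts G = {0..<n}"
    and E: "parcs G = {(u, v). u < n \<and> v < n \<and> (v = (u + s) mod n \<or> u = (v + s) mod n)}"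
  shows "is_cycle_graph G \<longleftrightarrow> gcd n s = 1"
proof
  assume "is_cycle_graph G"
  then obtain m f where m: "3 \<le> m" and f: "pverts G = f ` {..<m}"
      "parcs G = consecutive_pairs m f \<union> (consecutive_pairs m f)\<inverse>"
    unfolding is_cycle_graph_iff_enumeration by blast
  define g where "g = gcd n s"
  have shift: "((u + s) mod n) mod g = u mod g" for u
  proof -
    have "((u + s) mod n) mod g = (u + s) mod g"
      by (rule mod_mod_cancel) (simp add: g_def)
    also have "\<dots> = (u + s mod g) mod g" by (simp add: mod_add_right_eq)
    also have "s mod g = 0" by (simp add: g_def)
    finally show ?thesis by simp
  qed
  have const: "f t mod g = f 0 mod g" if "t < m" for t
    using that
  proof (induction t)
    case (Suc t)
    then have "(f t, f (Suc t)) \<in> parcs G"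
      unfolding f(2) consecutive_pairs_def by (intro UnI1 image_eqI[of _ _ t]) auto
    then have "f (Suc t) mod g = f t mod g" using shift E by auto
    then show ?case using Suc by simp
  qed simp
  have "0 \<in> f ` {..<m}" "1 \<in> f ` {..<m}" using n V f(1) by auto
  then obtain a b where "a < m" "b < m" "f a = 0" "f b = 1" by (metis imageE lessThan_iff)
  then have "0 mod g = 1 mod g" using const by metis
  then have "g dvd 1" by (simp add: dvd_eq_mod_eq_0)
  then have "g = 1" by simp
  then show "gcd n s = 1" by (simp add: g_def)
next
  assume g: "gcd n s = 1"
  define f where "f t = t * s mod n" for t
  have inj: "inj_on f {..<n}"
  proof (rule inj_onI)
    fix a b assume ab: "a \<in> {..<n}" "b \<in> {..<n}" "f a = f b"
    then have "[a * s = b * s] (mod n)" by (simp add: f_def cong_def)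
    then have "[a = b] (mod n)"
      using g cong_mult_rcancel_nat[of s n a b] by (simp add: gcd.commute coprime_iff_gcd_eq_1)
    then show "a = b" using ab by (simp add: cong_def)
  qed
  have img: "f ` {..<n} = {..<n}"
    by (rule endo_inj_surj[OF _ _ inj]) (use n in \<open>auto simp: f_def\<close>)
  have step: "f (Suc t mod n) = (f t + s) mod n" for t
  proof -
    have "f (Suc t mod n) = Suc t * s mod n" unfolding f_def by (rule mod_mult_left_eq)
    also have "\<dots> = (t * s + s) mod n" by (simp add: add.commute)
    also have "\<dots> = (f t + s) mod n" unfolding f_def by (rule mod_add_left_eq[symmetric])
    finally show ?thesis .
  qed
  have "consecutive_pairs n f = (\<lambda>u. (u, (u + s) mod n)) ` f ` {..<n}"
    by (simp add: consecutive_pairs_def image_image step)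
  then have "consecutive_pairs n f = (\<lambda>u. (u, (u + s) mod n)) ` {..<n}"
    by (simp only: img)
  then have "parcs G = consecutive_pairs n f \<union> (consecutive_pairs n f)\<inverse>"
    using n by (auto simp: E)
  then show "is_cycle_graph G"
    unfolding is_cycle_graph_iff_enumeration using n inj img V
    by (metis lessThan_atLeast0)
qed

theorem theorem3p14:
  fixes n :: nat and T :: "'a :: zero_neq_one mat"
  assumes "is_toeplitz n T"
  shows "is_cycle_graph (row_graph T) \<longleftrightarrow>
    (\<exists>i\<^sub>1 i\<^sub>2 j\<^sub>1 j\<^sub>2. i\<^sub>1 < i\<^sub>2 \<and> j\<^sub>1 < j\<^sub>2 \<and>
       toeplitz_index_sets n {i\<^sub>1, i\<^sub>2} {j\<^sub>1, j\<^sub>2} \<and>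
       T = toeplitz_mat n {i\<^sub>1, i\<^sub>2} {j\<^sub>1, j\<^sub>2} \<and>
       i\<^sub>1 + j\<^sub>2 = n \<and> i\<^sub>2 + j\<^sub>1 = n \<and> gcd n (i\<^sub>1 + j\<^sub>1) = 1)"
proof -
  have coprime_iff: "is_cycle_graph (row_graph T) \<longleftrightarrow> gcd n (i + (n - i')) = 1"
    if "T = toeplitz_mat n {i, i'} {n - i', n - i}" "1 \<le> i" "i < i'" "i' < n" for i i'
    by (rule circulant_is_cycle_graph_iff[OF _ _ parcs_row_graph_complementary[OF that]])
      (use that in auto)
  show ?thesis
  proof
    assume cyc: "is_cycle_graph (row_graph T)"
    obtain \<alpha> \<beta> where ind: "toeplitz_index_sets n \<alpha> \<beta>" and T: "T = toeplitz_mat n \<alpha> \<beta>"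
      using assms unfolding is_toeplitz_def by blast
    then have sub: "\<alpha> \<subseteq> {1..<n}" "\<beta> \<subseteq> {1..<n}" and n: "0 < n"
      by (auto simp: toeplitz_index_sets_def)
    have "T $$ (k, k) \<noteq> 1" if "k < n" for k
      using sub that by (auto simp: T toeplitz_mat_def)
    then have two: "card (column_ones T k) = 2" if "k < n" for k
      using column_ones_card_eq_2 cyc T that by (metis dim_toeplitz_mat)
    have "\<beta> = (\<lambda>i. n - i) ` \<alpha>"
      using index_sets_complementary_if_columns_equicardinal[OF T sub two] .
    moreover have "card \<alpha> = 2"
      using two[OF n] unfolding T column_zero_toeplitz[OF sub n] .
    then obtain i i' where i: "\<alpha> = {i, i'}" "i < i'"
      by (metis card_2_iff insert_commute linorder_neq_iff)
    ultimately have \<beta>: "\<beta> = {n - i', n - i}" by auto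
    have bounds: "1 \<le> i" "i' < n" using sub i by auto
    have gcd: "gcd n (i + (n - i')) = 1"
      using coprime_iff[OF T[unfolded i \<beta>] bounds(1) i(2) bounds(2)] cyc by simp
    show "\<exists>i\<^sub>1 i\<^sub>2 j\<^sub>1 j\<^sub>2. i\<^sub>1 < i\<^sub>2 \<and> j\<^sub>1 < j\<^sub>2 \<and>
       toeplitz_index_sets n {i\<^sub>1, i\<^sub>2} {j\<^sub>1, j\<^sub>2} \<and>
       T = toeplitz_mat n {i\<^sub>1, i\<^sub>2} {j\<^sub>1, j\<^sub>2} \<and>
       i\<^sub>1 + j\<^sub>2 = n \<and> i\<^sub>2 + j\<^sub>1 = n \<and> gcd n (i\<^sub>1 + j\<^sub>1) = 1"
    proof (intro exI conjI)
      show "i < i'" "n - i' < n - i" "i + (n - i) = n" "i' + (n - i') = n" using i bounds by auto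
      show "toeplitz_index_sets n {i, i'} {n - i', n - i}" using ind unfolding i \<beta> .
      show "T = toeplitz_mat n {i, i'} {n - i', n - i}" using T unfolding i \<beta> .
    qed (fact gcd)
  next
    assume "\<exists>i\<^sub>1 i\<^sub>2 j\<^sub>1 j\<^sub>2. i\<^sub>1 < i\<^sub>2 \<and> j\<^sub>1 < j\<^sub>2 \<and>
       toeplitz_index_sets n {i\<^sub>1, i\<^sub>2} {j\<^sub>1, j\<^sub>2} \<and>
       T = toeplitz_mat n {i\<^sub>1, i\<^sub>2} {j\<^sub>1, j\<^sub>2} \<and>
       i\<^sub>1 + j\<^sub>2 = n \<and> i\<^sub>2 + j\<^sub>1 = n \<and> gcd n (i\<^sub>1 + j\<^sub>1) = 1"
    then obtain i i' j j' where *: "i < i' \<and> j < j' \<and>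
        toeplitz_index_sets n {i, i'} {j, j'} \<and> T = toeplitz_mat n {i, i'} {j, j'} \<and>
        i + j' = n \<and> i' + j = n \<and> gcd n (i + j) = 1"
      by (elim exE) (rule that)
    then have T: "T = toeplitz_mat n {i, i'} {j, j'}" and "i < i'" and gcd: "gcd n (i + j) = 1"
      by simp_all
    have j: "j = n - i'" "j' = n - i" using * by linarith+
    have bounds: "1 \<le> i" "i' < n" using * by (simp_all add: toeplitz_index_sets_def)
    show "is_cycle_graph (row_graph T)"
      using coprime_iff[OF T[unfolded j] bounds(1) \<open>i < i'\<close> bounds(2)] gcd unfolding j by simp
  qed
qed

end
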